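(* Let $d\ge2$ be even, let $p$ be a form in $n$ variables and of degree $d$, and let $p_{\min}:=\min_{x\in\mathbb{S}^{n-1}}p(x)$. Let $\mathcal{D}_d^m$, $m\ge1$, be the family of algebraic disjunctions of $\mathbb{R}^n$ defined in the context, and for each $m$ let $p^{(m)}$ be the optimal value of $$\max_{\gamma\in\mathbb{R}}\ \gamma\quad\text{s.t.}\quad p(x)-\gamma\|x\|_2^d\in\mathbf{\Sigma}_{n,d}^d(\mathcal{D}_d^m).$$ Then $p_{\min}-p^{(m)}=O(1/m)$ as $m\to\infty$.
   Context: A form is a homogeneous polynomial with real coefficients; $\mathbb{S}^{n-1}$ is the Euclidean unit sphere in $\mathbb{R}^n$. A polynomial is a sum of squares (sos) if it is a finite sum of squares of real polynomials. Algebraic disjunction: let $r,n_1,\ldots,n_r$ be positive integers. A collection of sets of real polynomials in $n$ variables $\mathcal{D}=\{\{q_{k,j}\}_{j=1,\ldots,n_k},\ k=1,\ldots,r\}$ is an algebraic disjunction of $\mathbb{R}^n$ if $\mathbb{R}^n=\bigcup_{k=1}^r\Omega_k$, where $\Omega_k=\{x\in\mathbb{R}^n\mid q_{k,j}(x)\ge 0,\ j=1,\ldots,n_k\}$. For an algebraic disjunction $\mathcal{D}=\{\{q_{k,j}\}_{j=1,\ldots,n_k},\ k=1,\ldots,r\}$ of $\mathbb{R}^n$ and an integer $\bar d\ge d$, $\mathbf{\Sigma}_{n,d}^{\bar d}(\mathcal{D})$ is the set of real polynomials $p$ in $n$ variables of degree at most $d$ for which there exist sos polynomials $s_{k,j}$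 ($k=1,\ldots,r$, $j=0,1,\ldots,n_k$) such that for every $k=1,\ldots,r$, $p(x)=s_{k,0}(x)+\sum_{j=1}^{n_k}s_{k,j}(x)q_{k,j}(x)$, with $\deg s_{k,0}\le\bar d$ and $\deg(s_{k,j}q_{k,j})\le\bar d$ for all $j=1,\ldots,n_k$. The family $\mathcal{D}_d^m$: for $x^*\in\mathbb{S}^{n-1}$ let $h_d(x;x^* ):=\sum_{k=1}^{d/2}\left(\|x\|_2^2-(x^Tx^* )^2\right)^k(x^Tx^* )^{d-2k}$. Set $\mathcal{D}_d^1=\{\{0\}\}$. For each integer $m\ge2$, fix a finite net $\mathcal{N}_m=\{x^1,\ldots,x^{r_m}\}\subset\mathbb{S}^{n-1}$ such that for every $y\in\mathbb{S}^{n-1}$ there exists $x\in\mathcal{N}_m$ with $\langle x,y\rangle\ge m/\sqrt{m^2+1}$, let $t_m=\left(\sum_{k=1}^{d/2}m^{-2k}\right)^{-1}$, and set $$\mathcal{D}_d^m=\big\{\{(x^Tx^i)^d-t_mh_d(x;x^i)\},\ i=1,\ldots,r_m\big\}.$$ (These are algebraic disjunctions of $\mathbb{R}^n$, each subset of which contains exactly one form of degree $d$ when $m\ge 2$.) *)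

theory Defs
  imports "HOL-Analysis.Analysis" "HOL-Library.Poly_Mapping" "HOL-Library.Landau_Symbols"
begin

text \<open>
  Real polynomials in variables indexed by a finite type \<open>'n\<close> (so \<open>n = CARD('n)\<close>): a finitely
  supported map sends each exponent vector to its coefficient, and the ring operations are those
  of \<^type>\<open>poly_mapping\<close>.
\<close>

type_synonym 'n rpoly = "('n \<Rightarrow>\<^sub>0 nat) \<Rightarrow>\<^sub>0 real"

definition monom_degree :: "('n::finite \<Rightarrow>\<^sub>0 nat) \<Rightarrow> nat" where
  "monom_degree a = (\<Sum>i\<in>UNIV. Poly_Mapping.lookup a i)"

text \<open>The zero polynomial gets degree 0; degrees are only ever bounded from above.\<close>

definition total_degree :: "'n::finite rpoly \<Rightarrow> nat" where
  "total_degree p = Max (insert 0 (monom_degree ` Poly_Mapping.keys p))"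

definition is_form :: "nat \<Rightarrow> 'n::finite rpoly \<Rightarrow> bool" where
  "is_form d p \<longleftrightarrow> (\<forall>a\<in>Poly_Mapping.keys p. monom_degree a = d)"

definition monom_value :: "('n::finite \<Rightarrow>\<^sub>0 nat) \<Rightarrow> real ^ 'n \<Rightarrow> real" where
  "monom_value a x = (\<Prod>i\<in>UNIV. (x $ i) ^ Poly_Mapping.lookup a i)"

definition poly_value :: "'n::finite rpoly \<Rightarrow> real ^ 'n \<Rightarrow> real" where
  "poly_value p x = (\<Sum>a\<in>Poly_Mapping.keys p. Poly_Mapping.lookup p a * monom_value a x)"

definition Cst :: "real \<Rightarrow> 'n::finite rpoly" where
  "Cst c = Poly_Mapping.single 0 c"

definition Var :: "'n::finite \<Rightarrow> 'n rpoly" where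
  "Var i = Poly_Mapping.single (Poly_Mapping.single i 1) 1"

definition sos :: "'n::finite rpoly \<Rightarrow> bool" where
  "sos p \<longleftrightarrow> (\<exists>(k::nat) f. p = (\<Sum>i<k. f i ^ 2))"

definition disj_region :: "'n::finite rpoly set \<Rightarrow> (real ^ 'n) set" where
  "disj_region Q = {x. \<forall>q\<in>Q. poly_value q x \<ge> 0}"

definition algebraic_disjunction :: "'n::finite rpoly set set \<Rightarrow> bool" where
  "algebraic_disjunction D \<longleftrightarrow>
     finite D \<and> D \<noteq> {} \<and> (\<forall>Q\<in>D. finite Q \<and> Q \<noteq> {}) \<and> (\<Union>Q\<in>D. disj_region Q) = UNIV"

definition disj_cone :: "nat \<Rightarrow> nat \<Rightarrow> 'n::finite rpoly set set \<Rightarrow> 'n rpoly set" where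
  "disj_cone d dbar D =
     {p. total_degree p \<le> d \<and>
         (\<forall>Q\<in>D. \<exists>s0 s. sos s0 \<and> (\<forall>q\<in>Q. sos (s q)) \<and>
            p = s0 + (\<Sum>q\<in>Q. s q * q) \<and>
            total_degree s0 \<le> dbar \<and> (\<forall>q\<in>Q. total_degree (s q * q) \<le> dbar))}"

definition norm2_poly :: "'n::finite rpoly" where
  "norm2_poly = (\<Sum>i\<in>UNIV. Var i ^ 2)"

definition lin_poly :: "real ^ 'n \<Rightarrow> 'n::finite rpoly" where
  "lin_poly a = (\<Sum>i\<in>UNIV. Cst (a $ i) * Var i)"

definition h_poly :: "nat \<Rightarrow> real ^ 'n \<Rightarrow> 'n::finite rpoly" where
  "h_poly d a = (\<Sum>k=1..d div 2. (norm2_poly - lin_poly a ^ 2) ^ k * lin_poly a ^ (d - 2 * k))"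

definition t_const :: "nat \<Rightarrow> nat \<Rightarrow> real" where
  "t_const d m = inverse (\<Sum>k=1..d div 2. 1 / real m ^ (2 * k))"

definition cap_poly :: "nat \<Rightarrow> nat \<Rightarrow> real ^ 'n \<Rightarrow> 'n::finite rpoly" where
  "cap_poly d m a = lin_poly a ^ d - Cst (t_const d m) * h_poly d a"

definition sphere_net :: "nat \<Rightarrow> (real ^ 'n::finite) set \<Rightarrow> bool" where
  "sphere_net m A \<longleftrightarrow> finite A \<and> A \<subseteq> sphere 0 1 \<and>
     (\<forall>y\<in>sphere 0 1. \<exists>x\<in>A. x \<bullet> y \<ge> real m / sqrt (real m ^ 2 + 1))"

text \<open>The index \<open>m = 0\<close> is outside the family; it is lumped with \<open>m = 1\<close>.\<close>

definition disj_family :: "nat \<Rightarrow> (nat \<Rightarrow> (real ^ 'n) set) \<Rightarrow> nat \<Rightarrow> 'n::finite rpoly set set" where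
  "disj_family d N m = (if m \<le> 1 then {{0}} else (\<lambda>a. {cap_poly d m a}) ` N m)"

text \<open>For even \<open>d\<close>, \<open>norm2_poly ^ (d div 2)\<close> is the \<open>d\<close>-th power of the Euclidean norm.\<close>

definition feasible_gammas :: "nat \<Rightarrow> 'n::finite rpoly \<Rightarrow> 'n rpoly set set \<Rightarrow> real set" where
  "feasible_gammas d p D = {\<gamma>. p - Cst \<gamma> * norm2_poly ^ (d div 2) \<in> disj_cone d d D}"

definition opt_value :: "nat \<Rightarrow> 'n::finite rpoly \<Rightarrow> 'n rpoly set set \<Rightarrow> real" where
  "opt_value d p D = Sup (feasible_gammas d p D)"

definition sphere_min :: "'n::finite rpoly \<Rightarrow> real" where
  "sphere_min p = (INF x\<in>sphere 0 1. poly_value p x)"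


lemma poly_value_0 [simp]: "poly_value 0 x = 0"
  by (simp add: poly_value_def)

lemma poly_value_single [simp]: "poly_value (Poly_Mapping.single a c) x = c * monom_value a x"
  by (simp add: poly_value_def)

lemma poly_value_add [simp]: "poly_value (p + q) x = poly_value p x + poly_value q x"
  unfolding poly_value_def
  by (rule setsum_keys_plus_distrib) (simp_all add: algebra_simps)

lemma poly_value_minus [simp]: "poly_value (- p) x = - poly_value p x"
  using poly_value_add[of p "- p" x] by simp

lemma poly_value_diff [simp]: "poly_value (p - q) x = poly_value p x - poly_value q x"
  using poly_value_add[of p "- q" x] by simp

lemma poly_value_sum [simp]: "poly_value (sum f A) x = (\<Sum>i\<in>A. poly_value (f i) x)"
  by (induction A rule: infinite_finite_induct) simp_all

lemma monom_value_add: "monom_value (a + b) x = monom_value a x * monom_value b x"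
  by (simp add: monom_value_def lookup_add power_add prod.distrib)

lemma monom_value_0 [simp]: "monom_value 0 x = 1"
  by (simp add: monom_value_def)

lemma rpoly_as_sum:
  "(p :: 'n::finite rpoly) = (\<Sum>a\<in>Poly_Mapping.keys p. Poly_Mapping.single a (Poly_Mapping.lookup p a))"
  by (rule poly_mapping_eqI)
     (simp add: lookup_sum lookup_single when_def sum.delta in_keys_iff)

lemma poly_value_mult [simp]: "poly_value (p * q) x = poly_value p x * poly_value q x"
proof -
  let ?S = "\<lambda>p. (\<Sum>a\<in>Poly_Mapping.keys p. Poly_Mapping.single a (Poly_Mapping.lookup p a))"
  have "poly_value (p * q) x = poly_value (?S p * ?S q) x"
    using rpoly_as_sum[of p] rpoly_as_sum[of q] by simp
  also have "\<dots> = (\<Sum>a\<in>Poly_Mapping.keys p. \<Sum>b\<in>Poly_Mapping.keys q.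
      (Poly_Mapping.lookup p a * monom_value a x) * (Poly_Mapping.lookup q b * monom_value b x))"
    by (simp add: sum_product mult_single monom_value_add mult_ac)
  also have "\<dots> = poly_value p x * poly_value q x"
    by (simp add: poly_value_def sum_product)
  finally show ?thesis .
qed

lemma poly_value_Cst [simp]: "poly_value (Cst c) x = c"
  by (simp add: Cst_def)

lemma poly_value_1 [simp]: "poly_value 1 x = 1"
  using poly_value_single[of 0 1 x] by simp

lemma poly_value_power [simp]: "poly_value (p ^ k) x = poly_value p x ^ k"
  by (induction k) simp_all

lemma poly_value_Var [simp]: "poly_value (Var i) x = x $ i"
  by (simp add: Var_def monom_value_def lookup_single when_def if_distrib[of "\<lambda>k. _ ^ k"] cong: if_cong)

lemma poly_value_lin_poly [simp]: "poly_value (lin_poly a) x = x \<bullet> a"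
  by (simp add: lin_poly_def inner_vec_def mult.commute)

lemma poly_value_norm2_poly [simp]: "poly_value norm2_poly x = norm x ^ 2"
  by (simp add: norm2_poly_def power2_norm_eq_inner inner_vec_def) (simp add: power2_eq_square)

lemma poly_value_cap_poly:
  "poly_value (cap_poly d m a) x =
     (x \<bullet> a) ^ d - t_const d m * (\<Sum>k=1..d div 2. (norm x ^ 2 - (x \<bullet> a) ^ 2) ^ k * (x \<bullet> a) ^ (d - 2 * k))"
  by (simp add: cap_poly_def h_poly_def)

lemma cap_poly_nonneg:
  assumes d: "even d" "d \<ge> 2" and m: "m \<ge> 1"
    and nx: "norm x = 1" and c: "x \<bullet> a \<ge> real m / sqrt (real m ^ 2 + 1)" and a: "norm a = 1"
  shows "poly_value (cap_poly d m a) x \<ge> 0"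
proof -
  define c where "c = x \<bullet> a"
  have mpos: "real m > 0" using m by simp
  have "0 < real m / sqrt (real m ^ 2 + 1)" using mpos by (simp add: add_pos_pos)
  then have cpos: "c > 0" using c by (simp add: c_def)
  have "(real m / sqrt (real m ^ 2 + 1)) ^ 2 \<le> c ^ 2"
    using c mpos unfolding c_def by (intro power_mono) auto
  then have "real m ^ 2 / (real m ^ 2 + 1) \<le> c ^ 2" by (simp add: power_divide)
  then have u: "1 - c ^ 2 \<le> c ^ 2 / real m ^ 2"
    using mpos by (simp add: field_simps add_pos_pos)
  have "\<bar>c\<bar> \<le> 1" using Cauchy_Schwarz_ineq2[of x a] nx a by (simp add: c_def)
  then have u0: "0 \<le> 1 - c ^ 2" by (simp add: abs_square_le_1)
  let ?S = "\<Sum>k=1..d div 2. 1 / real m ^ (2 * k)"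
  have Spos: "?S > 0" using d mpos by (intro sum_pos) auto
  have "(1 - c ^ 2) ^ k * c ^ (d - 2 * k) \<le> c ^ d * (1 / real m ^ (2 * k))"
    if k: "k \<in> {1..d div 2}" for k
  proof -
    have "(1 - c ^ 2) ^ k \<le> (c ^ 2 / real m ^ 2) ^ k" using u u0 by (rule power_mono)
    also have "\<dots> = c ^ (2 * k) / real m ^ (2 * k)" by (simp add: power_divide power_mult)
    finally have "(1 - c ^ 2) ^ k * c ^ (d - 2 * k) \<le> c ^ (2 * k) / real m ^ (2 * k) * c ^ (d - 2 * k)"
      using cpos by (intro mult_right_mono) auto
    also have "\<dots> = c ^ (2 * k + (d - 2 * k)) / real m ^ (2 * k)" by (simp add: power_add)
    also have "2 * k + (d - 2 * k) = d" using k by auto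
    finally show ?thesis by simp
  qed
  then have "(\<Sum>k=1..d div 2. (1 - c ^ 2) ^ k * c ^ (d - 2 * k)) \<le> c ^ d * ?S"
    unfolding sum_distrib_left by (rule sum_mono)
  then have "t_const d m * (\<Sum>k=1..d div 2. (1 - c ^ 2) ^ k * c ^ (d - 2 * k)) \<le> inverse ?S * (c ^ d * ?S)"
    unfolding t_const_def using Spos by (intro mult_left_mono) auto
  also have "\<dots> = c ^ d" using Spos by simp
  finally show ?thesis by (simp add: poly_value_cap_poly nx flip: c_def)
qed

lemma poly_value_cap_poly_scaleR:
  "poly_value (cap_poly d m a) (r *\<^sub>R x) = r ^ d * poly_value (cap_poly d m a) x"
proof -
  have "(norm (r *\<^sub>R x) ^ 2 - ((r *\<^sub>R x) \<bullet> a) ^ 2) ^ k * ((r *\<^sub>R x) \<bullet> a) ^ (d - 2 * k)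
      = r ^ d * ((norm x ^ 2 - (x \<bullet> a) ^ 2) ^ k * (x \<bullet> a) ^ (d - 2 * k))"
    if k: "k \<in> {1..d div 2}" for k
  proof -
    have "norm (r *\<^sub>R x) ^ 2 - ((r *\<^sub>R x) \<bullet> a) ^ 2 = r ^ 2 * (norm x ^ 2 - (x \<bullet> a) ^ 2)"
      by (simp add: power_mult_distrib algebra_simps)
    moreover have "r ^ (2 * k) * r ^ (d - 2 * k) = r ^ d"
      using k by (auto simp flip: power_add)
    ultimately show ?thesis
      by (simp add: power_mult_distrib power_mult[symmetric] mult_ac)
  qed
  then have "(\<Sum>k=1..d div 2. (norm (r *\<^sub>R x) ^ 2 - ((r *\<^sub>R x) \<bullet> a) ^ 2) ^ k * ((r *\<^sub>R x) \<bullet> a) ^ (d - 2 * k))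
      = r ^ d * (\<Sum>k=1..d div 2. (norm x ^ 2 - (x \<bullet> a) ^ 2) ^ k * (x \<bullet> a) ^ (d - 2 * k))"
    unfolding sum_distrib_left by (rule sum.cong[OF refl])
  moreover have "((r *\<^sub>R x) \<bullet> a) ^ d = r ^ d * (x \<bullet> a) ^ d"
    by (simp add: power_mult_distrib)
  ultimately show ?thesis
    unfolding poly_value_cap_poly by (simp only: right_diff_distrib mult.left_commute)
qed

lemma algebraic_disjunction_disj_family:
  fixes N :: "nat \<Rightarrow> (real ^ 'n::finite) set"
  assumes d: "even d" "d \<ge> 2" and net: "\<And>m. m \<ge> 2 \<Longrightarrow> sphere_net m (N m)"
  shows "algebraic_disjunction (disj_family d N m)"
proof (cases "m \<le> 1")
  case True
  then show ?thesis by (simp add: algebraic_disjunction_def disj_family_def disj_region_def)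
next
  case False
  then have n: "sphere_net m (N m)" using net by simp
  have "\<exists>a\<in>N m. poly_value (cap_poly d m a) x \<ge> 0" for x
  proof -
    obtain y :: "real ^ 'n" where y: "norm y = 1" "x = norm x *\<^sub>R y"
    proof (cases "x = 0")
      case True
      obtain y :: "real ^ 'n" where "norm y = 1" using vector_choose_size[of 1] by auto
      then show ?thesis using that True by simp
    next
      case False
      then show ?thesis using that[of "x /\<^sub>R norm x"] by simp
    qed
    then obtain a where a: "a \<in> N m" "a \<bullet> y \<ge> real m / sqrt (real m ^ 2 + 1)"
      using n unfolding sphere_net_def by (metis dist_0_norm mem_sphere)
    then have "norm a = 1" using n unfolding sphere_net_def by (auto simp: dist_norm)
    then have "poly_value (cap_poly d m a) y \<ge> 0"
      using cap_poly_nonneg[OF d, of m y a] a False y by (simp add: inner_commute)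
    then have "poly_value (cap_poly d m a) (norm x *\<^sub>R y) \<ge> 0"
      by (simp add: poly_value_cap_poly_scaleR)
    with y a show ?thesis by auto
  qed
  moreover have "N m \<noteq> {}" using calculation by blast
  ultimately show ?thesis
    using n False
    by (auto simp: algebraic_disjunction_def disj_family_def disj_region_def sphere_net_def)
qed

end

theory Submission
  imports Defs
begin

text \<open>
  Fix a unit vector \<open>a\<close>, write \<open>u\<close> for the linear form of \<open>a\<close>, and split each variable as
  \<open>Var i = a\<^sub>i u + w\<^sub>i\<close>, where the \<open>w\<^sub>i\<close> are the components orthogonal to \<open>a\<close>, so that
  \<open>W = |x|\<^sup>2 - u\<^sup>2\<close> is the sum of the \<open>w\<^sub>i\<^sup>2\<close>. Expanding a form \<open>q\<close> of even degree \<open>d\<close> in these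
  coordinates produces \<open>q(a) u\<^sup>d\<close> together with terms that contain at least one factor \<open>w\<^sub>i\<close>. Each of
  these mixed terms is a product of two forms of degree \<open>d/2\<close>, one with \<open>\<lfloor>j/2\<rfloor>\<close> and one with
  \<open>\<lceil>j/2\<rceil>\<close> of the \<open>j \<ge> 1\<close> factors \<open>w\<^sub>i\<close>, so the weighted inequality
  \<open>\<bar>fg\<bar> \<le> (\<epsilon>f\<^sup>2 + g\<^sup>2/\<epsilon>)/2\<close>, whose gap is a sum of squares, bounds it by \<open>\<epsilon> u\<^sup>d + h/\<epsilon>\<close> with
  \<open>h = \<Sum>\<^bsub>1 \<le> k \<le> d/2\<^esub> W\<^sup>k u\<^bsup>d-2k\<^esup>\<close> (\<open>mixed_term_bound\<close>). Hence, modulo sums of squares,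
  \<open>q \<ge> q(a) u\<^sup>d - M (\<epsilon> u\<^sup>d + h/\<epsilon>)\<close> with \<open>M\<close> depending only on \<open>d\<close> and the coefficients of \<open>q\<close>
  (\<open>form_lower_bound\<close>).

  The cap polynomial is \<open>u\<^sup>d - t h\<close> with \<open>t \<ge> m\<^sup>2/d\<close>. Take \<open>q = p - p\<^bsub>min\<^esub> |x|\<^sup>d\<close>, which is nonnegative at
  \<open>a\<close>, and \<open>\<epsilon> = 1/m\<close>. Adding \<open>\<delta> |x|\<^sup>d \<ge> \<delta> u\<^sup>d\<close> and subtracting \<open>\<mu>\<close> times the cap polynomial leaves the
  coefficient \<open>\<delta> - \<mu> - M/m\<close> on \<open>u\<^sup>d\<close> and \<open>\<mu> t - M m\<close> on \<open>h\<close>. Both are nonnegative for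
  \<open>\<mu> = M d/m\<close> and \<open>\<delta> = M (d + 1)/m\<close> (\<open>cap_certificate\<close>). The multiplier of the cap polynomial is thus a
  constant, no degree exceeds \<open>d\<close>, and \<open>\<delta>\<close> is the same for every \<open>a\<close> of the net: the value
  \<open>p\<^bsub>min\<^esub> - \<delta>\<close> is feasible, at distance \<open>O(1/m)\<close> from \<open>p\<^bsub>min\<^esub>\<close>. No feasible value exceeds \<open>p\<^bsub>min\<^esub>\<close>, because the
  regions of a disjunction cover the sphere and each certificate is nonnegative on its region.
\<close>

section \<open>Sums of squares and the order they induce\<close>

lemma Cst_0 [simp]: "Cst 0 = 0"
  by (simp add: Cst_def)

lemma Cst_1 [simp]: "Cst 1 = 1"
  by (simp add: Cst_def)

lemma Cst_add: "Cst (b + c) = Cst b + Cst c"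
  by (simp add: Cst_def single_add)

lemma Cst_diff: "Cst (b - c) = Cst b - Cst c"
  by (simp add: Cst_def single_diff)

lemma Cst_mult: "Cst (b * c) = Cst b * Cst c"
  by (simp add: Cst_def mult_single)

lemma Cst_power: "Cst (c ^ k) = Cst c ^ k"
  by (induction k) (simp_all add: Cst_mult)

lemma Cst_sum: "Cst (sum f A) = (\<Sum>i\<in>A. Cst (f i))"
  by (induction A rule: infinite_finite_induct) (simp_all add: Cst_add)

lemma Cst_prod: "Cst (prod f A) = (\<Prod>i\<in>A. Cst (f i))"
  by (induction A rule: infinite_finite_induct) (simp_all add: Cst_mult)

lemma sos_0 [simp]: "sos 0"
  unfolding sos_def by (rule exI[of _ 0]) simp

lemma sos_add_square:
  assumes "sos p" shows "sos (p + q ^ 2)"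
proof -
  obtain k :: nat and f where "p = (\<Sum>i<k. f i ^ 2)" using assms unfolding sos_def by blast
  then have "p + q ^ 2 = (\<Sum>i<Suc k. (f(k := q)) i ^ 2)" by simp
  then show ?thesis unfolding sos_def by blast
qed

lemma sos_square: "sos (q ^ 2)"
  using sos_add_square[OF sos_0] by simp

lemma sos_add:
  assumes "sos p" "sos q" shows "sos (p + q)"
proof -
  obtain k :: nat and f where q: "q = (\<Sum>i<k. f i ^ 2)" using assms unfolding sos_def by blast
  have "sos (p + (\<Sum>i<k. f i ^ 2))"
    using assms(1) by (induction k) (auto simp: sos_add_square simp flip: add.assoc)
  then show ?thesis using q by simp
qed

lemma sos_sum:
  assumes "\<And>i. i \<in> A \<Longrightarrow> sos (f i)" shows "sos (sum f A)"
  using assms by (induction A rule: infinite_finite_induct) (simp_all add: sos_add)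

lemma sos_mult:
  assumes "sos p" "sos q" shows "sos (p * q)"
proof -
  obtain k :: nat and f where p: "p = (\<Sum>i<k. f i ^ 2)" using assms unfolding sos_def by blast
  obtain l :: nat and g where q: "q = (\<Sum>i<l. g i ^ 2)" using assms unfolding sos_def by blast
  have "p * q = (\<Sum>i<k. \<Sum>j<l. (f i * g j) ^ 2)"
    by (simp add: p q sum_product power_mult_distrib)
  then show ?thesis by (simp add: sos_sum sos_square)
qed

lemma sos_Cst:
  assumes "c \<ge> 0" shows "sos (Cst c)"
  using sos_square[of "Cst (sqrt c)"] assms by (simp flip: Cst_power)

lemma sos_1 [simp]: "sos 1"
  using sos_Cst[of 1] by simp

lemma sos_power: "sos p \<Longrightarrow> sos (p ^ k)"
  by (induction k) (simp_all add: sos_mult)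

lemma sos_even_power: "even k \<Longrightarrow> sos (q ^ k)"
  using sos_power[OF sos_square, of q "k div 2"] by (simp flip: power_mult)

lemma poly_value_sos_nonneg: "sos p \<Longrightarrow> poly_value p x \<ge> 0"
  unfolding sos_def by (auto intro!: sum_nonneg)

text \<open>
  All the estimates below are inequalities in this preorder, which is compatible with sums and with
  products by sums of squares; a proof of \<open>p \<preceq> q\<close> is a certificate, not just a pointwise bound.
\<close>

definition sos_le :: "'n::finite rpoly \<Rightarrow> 'n rpoly \<Rightarrow> bool" (infix "\<preceq>" 50) where
  "p \<preceq> q \<longleftrightarrow> sos (q - p)"

lemma sos_le_refl: "p \<preceq> p"
  by (simp add: sos_le_def)

lemma sos_le_trans [trans]: "p \<preceq> q \<Longrightarrow> q \<preceq> r \<Longrightarrow> p \<preceq> r"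
  unfolding sos_le_def using sos_add[of "q - p" "r - q"] by simp

lemma sos_le_add: "p \<preceq> q \<Longrightarrow> p' \<preceq> q' \<Longrightarrow> p + p' \<preceq> q + q'"
  unfolding sos_le_def using sos_add[of "q - p" "q' - p'"] by (simp add: algebra_simps)

lemma sos_le_sum: "(\<And>i. i \<in> A \<Longrightarrow> f i \<preceq> g i) \<Longrightarrow> sum f A \<preceq> sum g A"
  unfolding sos_le_def by (simp add: sos_sum flip: sum_subtractf)

lemma sos_le_mult_left: "sos r \<Longrightarrow> p \<preceq> q \<Longrightarrow> r * p \<preceq> r * q"
  unfolding sos_le_def using sos_mult[of r "q - p"] by (simp add: algebra_simps)

lemma sos_le_mult:
  assumes "p \<preceq> q" "p' \<preceq> q'" "sos p" "sos q'" shows "p * p' \<preceq> q * q'"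
proof -
  have "p * p' \<preceq> p * q'" using assms by (intro sos_le_mult_left)
  also have "p * q' \<preceq> q * q'" using sos_le_mult_left[of q' p q] assms by (simp add: mult.commute)
  finally show ?thesis .
qed

lemma sos_le_power:
  assumes "p \<preceq> q" "sos p" "sos q" shows "p ^ k \<preceq> q ^ k"
  by (induction k) (simp_all add: sos_le_refl sos_le_mult assms sos_power)

lemma sos_le_Cst_mult: "b \<le> c \<Longrightarrow> sos p \<Longrightarrow> Cst b * p \<preceq> Cst c * p"
  unfolding sos_le_def using sos_mult[of "Cst (c - b)" p] sos_Cst[of "c - b"]
  by (simp add: Cst_diff algebra_simps)

lemma sos_le_member_sum:
  assumes "finite A" "i \<in> A" "\<And>j. j \<in> A \<Longrightarrow> sos (f j)" shows "f i \<preceq> sum f A"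
  using assms sos_sum[of "A - {i}" f] by (simp add: sos_le_def sum.remove[of A i])

text \<open>
  The weights \<open>(c \<plusminus> \<kappa>) / 4\<epsilon>\<close> on \<open>(\<epsilon>f \<plusminus> g)\<^sup>2\<close> produce the cross term \<open>\<kappa>fg\<close> for either sign of
  \<open>\<kappa>\<close> and avoid a division by \<open>c\<close>, which may vanish.
\<close>

lemma sos_weighted_am_gm:
  assumes "\<epsilon> > 0" "\<bar>\<kappa>\<bar> \<le> c"
  shows "sos (Cst c * (Cst (\<epsilon> / 2) * f ^ 2 + Cst (1 / (2 * \<epsilon>)) * g ^ 2) + Cst \<kappa> * (f * g))"
proof -
  let ?b = "(c + \<kappa>) / (4 * \<epsilon>)" and ?b' = "(c - \<kappa>) / (4 * \<epsilon>)"
  have eq: "Cst ?b * (Cst \<epsilon> * f + g) ^ 2 + Cst ?b' * (Cst \<epsilon> * f - g) ^ 2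
    = Cst ((?b + ?b') * \<epsilon> ^ 2) * f ^ 2 + Cst (?b + ?b') * g ^ 2 + Cst ((?b - ?b') * 2 * \<epsilon>) * (f * g)"
  proof -
    define b b' e :: "'a rpoly" where "b = Cst ?b" and "b' = Cst ?b'" and "e = Cst \<epsilon>"
    have "Cst 2 = (2 :: 'a rpoly)" using Cst_add[of 1 1] by simp
    then show ?thesis
      unfolding Cst_mult Cst_add[of ?b ?b'] Cst_diff[of ?b ?b'] Cst_power
        b_def[symmetric] b'_def[symmetric] e_def[symmetric]
      by (simp add: algebra_simps power2_eq_square)
  qed
  have "(?b + ?b') * \<epsilon> ^ 2 = c * (\<epsilon> / 2)" "?b + ?b' = c * (1 / (2 * \<epsilon>))" "(?b - ?b') * 2 * \<epsilon> = \<kappa>"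
    using assms by (simp_all add: field_simps power2_eq_square)
  then have "Cst c * (Cst (\<epsilon> / 2) * f ^ 2 + Cst (1 / (2 * \<epsilon>)) * g ^ 2) + Cst \<kappa> * (f * g)
     = Cst ?b * (Cst \<epsilon> * f + g) ^ 2 + Cst ?b' * (Cst \<epsilon> * f - g) ^ 2"
    by (simp only: eq Cst_mult[of c] distrib_left mult.assoc)
  moreover have "?b \<ge> 0" "?b' \<ge> 0" using assms by auto
  ultimately show ?thesis by (simp only:) (intro sos_add sos_mult sos_Cst sos_square)
qed

section \<open>Forms\<close>

lemma monom_degree_add: "monom_degree (a + b) = monom_degree a + monom_degree b"
  by (simp add: monom_degree_def lookup_add sum.distrib)

lemma total_degree_form: "is_form d p \<Longrightarrow> total_degree p \<le> d"
  unfolding total_degree_def is_form_def by auto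

lemma is_form_0 [simp]: "is_form d 0"
  by (simp add: is_form_def)

lemma is_form_add: "is_form d p \<Longrightarrow> is_form d q \<Longrightarrow> is_form d (p + q)"
  unfolding is_form_def using keys_add[of p q] by blast

lemma is_form_diff: "is_form d p \<Longrightarrow> is_form d q \<Longrightarrow> is_form d (p - q)"
  unfolding is_form_def using keys_diff[of p q] by blast

lemma is_form_sum: "(\<And>i. i \<in> A \<Longrightarrow> is_form d (f i)) \<Longrightarrow> is_form d (sum f A)"
  by (induction A rule: infinite_finite_induct) (simp_all add: is_form_add)

lemma is_form_mult: "is_form d p \<Longrightarrow> is_form e q \<Longrightarrow> is_form (d + e) (p * q)"
  unfolding is_form_def using keys_mult[of p q] by (fastforce simp: monom_degree_add)

lemma is_form_Cst: "is_form 0 (Cst c)"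
  by (simp add: is_form_def Cst_def monom_degree_def)

lemma is_form_Cst_mult: "is_form d p \<Longrightarrow> is_form d (Cst c * p)"
  using is_form_mult[OF is_form_Cst] by fastforce

lemma is_form_power: "is_form d p \<Longrightarrow> is_form (k * d) (p ^ k)"
proof (induction k)
  case 0 then show ?case using is_form_Cst[of 1] by simp
next
  case (Suc k) then show ?case by (simp add: is_form_mult)
qed

lemma is_form_Var: "is_form 1 (Var i)"
  by (simp add: is_form_def Var_def monom_degree_def lookup_single when_def)

lemma is_form_norm2_poly: "is_form 2 norm2_poly"
  unfolding norm2_poly_def using is_form_power[OF is_form_Var, of 2] by (auto intro: is_form_sum)

lemma is_form_lin_poly: "is_form 1 (lin_poly a)"
  unfolding lin_poly_def by (intro is_form_sum is_form_Cst_mult is_form_Var)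

lemma is_form_norm2_power: "even d \<Longrightarrow> is_form d (norm2_poly ^ (d div 2))"
  using is_form_power[OF is_form_norm2_poly, of "d div 2"] by simp

lemma is_form_cap_poly: "is_form d (cap_poly d m a)"
proof -
  have l: "is_form k (lin_poly a ^ k)" for k
    using is_form_power[OF is_form_lin_poly, of k] by simp
  have "is_form d ((norm2_poly - lin_poly a ^ 2) ^ k * lin_poly a ^ (d - 2 * k))"
    if "k \<in> {1..d div 2}" for k
  proof -
    have "is_form (k * 2 + (d - 2 * k)) ((norm2_poly - lin_poly a ^ 2) ^ k * lin_poly a ^ (d - 2 * k))"
      by (intro is_form_mult is_form_power is_form_diff is_form_norm2_poly l)
    moreover have "k * 2 + (d - 2 * k) = d" using that by auto
    ultimately show ?thesis by simp
  qed
  then show ?thesis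
    unfolding cap_poly_def h_poly_def by (intro is_form_diff is_form_Cst_mult is_form_sum l)
qed

lemma Var_power: "Var i ^ k = Poly_Mapping.single (Poly_Mapping.single i k) 1"
  by (induction k) (simp_all add: Var_def mult_single flip: single_add)

lemma prod_single: "(\<Prod>i\<in>A. Poly_Mapping.single (f i) 1) = Poly_Mapping.single (sum f A) (1::real)"
  by (induction A rule: infinite_finite_induct) (simp_all add: mult_single)

text \<open>Writing a monomial as a product of variables makes a linear change of coordinates possible.\<close>

lemma single_eq_prod_Var:
  "Poly_Mapping.single \<alpha> c = Cst c * (\<Prod>i\<in>UNIV. Var i ^ Poly_Mapping.lookup \<alpha> (i::'n::finite))"
proof -
  have "(\<Sum>i\<in>UNIV. Poly_Mapping.single i (Poly_Mapping.lookup \<alpha> i)) = \<alpha>"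
    by (rule poly_mapping_eqI) (simp add: lookup_sum lookup_single when_def)
  then show ?thesis by (simp add: Var_power prod_single Cst_def mult_single)
qed

section \<open>Coordinates adapted to a unit vector\<close>

definition ortho_poly :: "real ^ 'n::finite \<Rightarrow> 'n \<Rightarrow> 'n rpoly" where
  "ortho_poly a i = Var i - Cst (a $ i) * lin_poly a"

text \<open>
  Pythagoras, as an identity of polynomials: it turns the factor \<open>|x|\<^sup>2 - (x\<^sup>Ta)\<^sup>2\<close> of the cap polynomials
  into a sum of squares.
\<close>

lemma sum_ortho_poly_squares:
  assumes "norm a = 1"
  shows "(\<Sum>i\<in>UNIV. ortho_poly a i ^ 2) = norm2_poly - lin_poly a ^ 2"
proof -
  have "(\<Sum>i\<in>UNIV. (a $ i) ^ 2) = 1"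
    using assms power2_norm_eq_inner[of a] by (simp add: inner_vec_def power2_eq_square)
  then have "(\<Sum>i\<in>UNIV. Cst (a $ i) ^ 2) = (1 :: 'a rpoly)"
    by (metis (no_types, lifting) Cst_1 Cst_power Cst_sum sum.cong)
  moreover have "(\<Sum>i\<in>UNIV. ortho_poly a i ^ 2)
     = norm2_poly - lin_poly a * lin_poly a - lin_poly a * lin_poly a
        + (\<Sum>i\<in>UNIV. Cst (a $ i) ^ 2) * lin_poly a ^ 2"
  proof -
    have "(\<Sum>i\<in>UNIV. ortho_poly a i ^ 2) = (\<Sum>i\<in>UNIV. Var i ^ 2 - Cst (a $ i) * Var i * lin_poly a
         - Cst (a $ i) * Var i * lin_poly a + Cst (a $ i) ^ 2 * lin_poly a ^ 2)"
      by (rule sum.cong) (simp_all add: ortho_poly_def power2_eq_square algebra_simps)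
    also have "\<dots> = norm2_poly - (\<Sum>i\<in>UNIV. Cst (a $ i) * Var i) * lin_poly a
        - (\<Sum>i\<in>UNIV. Cst (a $ i) * Var i) * lin_poly a + (\<Sum>i\<in>UNIV. Cst (a $ i) ^ 2) * lin_poly a ^ 2"
      by (simp only: sum.distrib sum_subtractf norm2_poly_def sum_distrib_right)
    also have "\<dots> = norm2_poly - lin_poly a * lin_poly a - lin_poly a * lin_poly a
        + (\<Sum>i\<in>UNIV. Cst (a $ i) ^ 2) * lin_poly a ^ 2"
      by (simp only: lin_poly_def[of a, symmetric])
    finally show ?thesis .
  qed
  ultimately show ?thesis by (simp add: power2_eq_square)
qed

lemma sos_ortho_norm2: "norm a = 1 \<Longrightarrow> sos (norm2_poly - lin_poly a ^ 2)"
  using sum_ortho_poly_squares[of a] sos_sum[of UNIV "\<lambda>i. ortho_poly a i ^ 2"]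
  by (simp add: sos_square)

text \<open>
  Each factor \<open>w\<^sub>i\<^sup>2\<close> is one summand of \<open>W\<close>. The index map \<open>v\<close> allows repeated factors, as powers of a
  variable need.
\<close>

lemma prod_ortho_square_le:
  assumes "norm a = 1" "finite S"
  shows "(\<Prod>s\<in>S. ortho_poly a (v s)) ^ 2 \<preceq> (norm2_poly - lin_poly a ^ 2) ^ card S"
  using assms(2)
proof (induction S rule: finite_induct)
  case empty then show ?case by (simp add: sos_le_refl)
next
  case (insert s S)
  have "ortho_poly a (v s) ^ 2 \<preceq> norm2_poly - lin_poly a ^ 2"
    unfolding sum_ortho_poly_squares[OF assms(1), symmetric]
    by (rule sos_le_member_sum) (simp_all add: sos_square)
  with insert show ?case
    by (simp add: power_mult_distrib sos_le_mult sos_square sos_power sos_ortho_norm2[OF assms(1)])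
qed

text \<open>
  The error term of the local expansion at \<open>a\<close>. The weight \<open>\<epsilon>\<close> trades the coefficient of \<open>u\<^sup>d\<close>, which
  costs objective value, against that of \<open>h\<close>, which the large factor \<open>t\<close> of the cap polynomial absorbs.
\<close>

definition cap_bound :: "nat \<Rightarrow> real \<Rightarrow> real ^ 'n::finite \<Rightarrow> 'n rpoly" where
  "cap_bound d \<epsilon> a = Cst \<epsilon> * lin_poly a ^ d + Cst (1 / \<epsilon>) * h_poly d a"

lemma sos_h_summand:
  assumes "norm a = 1" "even d"
  shows "sos ((norm2_poly - lin_poly a ^ 2) ^ k * lin_poly a ^ (d - 2 * k))"
  using assms by (intro sos_mult sos_power sos_ortho_norm2 sos_even_power) auto

lemma sos_h_poly: "norm a = 1 \<Longrightarrow> even d \<Longrightarrow> sos (h_poly d a)"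
  unfolding h_poly_def by (intro sos_sum sos_h_summand)

lemma h_summand_le:
  assumes "norm a = 1" "even d" "1 \<le> k" "k \<le> d div 2"
  shows "(norm2_poly - lin_poly a ^ 2) ^ k * lin_poly a ^ (d - 2 * k) \<preceq> h_poly d a"
  unfolding h_poly_def
  by (rule sos_le_member_sum[where f = "\<lambda>k. (norm2_poly - lin_poly a ^ 2) ^ k * lin_poly a ^ (d - 2 * k)"])
     (use assms in \<open>auto intro: sos_h_summand\<close>)

text \<open>
  The next two lemmas say which weights the error term affords for \<open>W\<^sup>k u\<^bsup>d-2k\<^esup>\<close>: the large weight
  \<open>1/\<epsilon>\<close> only if a factor \<open>W\<close> is present, the small weight \<open>\<epsilon>\<close> always.
\<close>

lemma cap_bound_upper:
  assumes a: "norm a = 1" and d: "even d" and k: "1 \<le> k" "k \<le> d div 2" and e: "0 < \<epsilon>"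
  shows "Cst (1 / \<epsilon>) * ((norm2_poly - lin_poly a ^ 2) ^ k * lin_poly a ^ (d - 2 * k)) \<preceq> cap_bound d \<epsilon> a"
    (is "_ * ?T \<preceq> _")
proof -
  have "Cst (1 / \<epsilon>) * ?T \<preceq> Cst (1 / \<epsilon>) * h_poly d a"
    using assms by (intro sos_le_mult_left sos_Cst h_summand_le) auto
  also have "\<dots> \<preceq> cap_bound d \<epsilon> a"
    unfolding cap_bound_def sos_le_def using d e by (simp add: sos_mult sos_Cst sos_even_power)
  finally show ?thesis .
qed

lemma cap_bound_lower:
  assumes a: "norm a = 1" and d: "even d" and k: "k \<le> d div 2" and e: "0 < \<epsilon>" "\<epsilon> \<le> 1"
  shows "Cst \<epsilon> * ((norm2_poly - lin_poly a ^ 2) ^ k * lin_poly a ^ (d - 2 * k)) \<preceq> cap_bound d \<epsilon> a"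
proof (cases "k = 0")
  case True
  then show ?thesis
    unfolding cap_bound_def sos_le_def using a d e by (simp add: sos_mult sos_Cst sos_h_poly)
next
  case False
  have "\<epsilon> * \<epsilon> \<le> 1" using e by (simp add: mult_le_one)
  then have "\<epsilon> \<le> 1 / \<epsilon>" using e by (simp add: field_simps)
  then have "Cst \<epsilon> * ((norm2_poly - lin_poly a ^ 2) ^ k * lin_poly a ^ (d - 2 * k))
     \<preceq> Cst (1 / \<epsilon>) * ((norm2_poly - lin_poly a ^ 2) ^ k * lin_poly a ^ (d - 2 * k))"
    using a d by (intro sos_le_Cst_mult sos_h_summand)
  also have "\<dots> \<preceq> cap_bound d \<epsilon> a" using assms False by (intro cap_bound_upper) auto
  finally show ?thesis .
qed

text \<open>
  Split the factors \<open>w\<close> as evenly as possible into \<open>S1\<close> and \<open>S2\<close> with \<open>card S1 \<le> card S2\<close>, and the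
  powers of \<open>u\<close> so that both halves have degree \<open>d/2\<close>. As \<open>S\<close> is nonempty, so is \<open>S2\<close>; its half can
  therefore carry the large weight \<open>1/\<epsilon>\<close> in the weighted inequality, while the half of \<open>S1\<close>,
  possibly a pure power of \<open>u\<close>, carries the small weight \<open>\<epsilon>\<close>.
\<close>

lemma mixed_term_bound:
  assumes a: "norm a = 1" and d: "even d" and e: "0 < \<epsilon>" "\<epsilon> \<le> 1"
    and S: "finite S" "S \<noteq> {}" "card S \<le> d" and c: "\<bar>\<kappa>\<bar> \<le> c"
  shows "sos (Cst c * cap_bound d \<epsilon> a
              + Cst \<kappa> * (lin_poly a ^ (d - card S) * (\<Prod>s\<in>S. ortho_poly a (v s))))"
proof -
  let ?W = "norm2_poly - lin_poly a ^ 2"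
  obtain S1 where S1: "S1 \<subseteq> S" "card S1 = card S div 2"
    using obtain_subset_with_card_n[of "card S div 2" S] by auto
  define S2 where "S2 = S - S1"
  have fin: "finite S1" "finite S2" using S S1 finite_subset unfolding S2_def by auto
  have card: "card S = card S1 + card S2"
    using S S1 fin unfolding S2_def by (simp add: card_Diff_subset card_mono)
  have pos: "card S > 0" using S by (simp add: card_gt_0_iff)
  have k: "card S1 \<le> d div 2" "1 \<le> card S2" "card S2 \<le> d div 2"
    using card S1(2) S(3) d pos by (auto elim!: evenE)
  define g1 where "g1 = (\<Prod>s\<in>S1. ortho_poly a (v s))"
  define g2 where "g2 = (\<Prod>s\<in>S2. ortho_poly a (v s))"
  define f1 where "f1 = lin_poly a ^ (d div 2 - card S1) * g1"
  define f2 where "f2 = lin_poly a ^ (d div 2 - card S2) * g2"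
  have sq: "(lin_poly a ^ (d div 2 - card T) * (\<Prod>s\<in>T. ortho_poly a (v s))) ^ 2
      \<preceq> ?W ^ card T * lin_poly a ^ (d - 2 * card T)" if "finite T" for T
  proof -
    have "(d div 2 - card T) * 2 = d - 2 * card T" using d by auto
    then have "(lin_poly a ^ (d div 2 - card T)) ^ 2 = lin_poly a ^ (d - 2 * card T)"
      by (simp flip: power_mult)
    moreover have "sos (lin_poly a ^ (d - 2 * card T))" using d by (intro sos_even_power) auto
    ultimately show ?thesis
      using sos_le_mult_left[OF _ prod_ortho_square_le[OF a that]]
      by (simp add: power_mult_distrib mult.commute)
  qed
  have "Cst (\<epsilon> / 2) * f1 ^ 2 \<preceq> Cst (1 / 2) * cap_bound d \<epsilon> a"
  proof -
    have "Cst \<epsilon> * f1 ^ 2 \<preceq> Cst \<epsilon> * (?W ^ card S1 * lin_poly a ^ (d - 2 * card S1))"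
      unfolding f1_def g1_def using e by (intro sos_le_mult_left sos_Cst sq fin) auto
    also have "\<dots> \<preceq> cap_bound d \<epsilon> a" by (rule cap_bound_lower) (fact a d k e)+
    finally have "Cst (1 / 2) * (Cst \<epsilon> * f1 ^ 2) \<preceq> Cst (1 / 2) * cap_bound d \<epsilon> a"
      by (intro sos_le_mult_left sos_Cst) auto
    then show ?thesis by (simp flip: mult.assoc Cst_mult)
  qed
  moreover have "Cst (1 / (2 * \<epsilon>)) * f2 ^ 2 \<preceq> Cst (1 / 2) * cap_bound d \<epsilon> a"
  proof -
    have "Cst (1 / \<epsilon>) * f2 ^ 2 \<preceq> Cst (1 / \<epsilon>) * (?W ^ card S2 * lin_poly a ^ (d - 2 * card S2))"
      unfolding f2_def g2_def using e by (intro sos_le_mult_left sos_Cst sq fin) auto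
    also have "\<dots> \<preceq> cap_bound d \<epsilon> a" by (rule cap_bound_upper) (fact a d k e)+
    finally have "Cst (1 / 2) * (Cst (1 / \<epsilon>) * f2 ^ 2) \<preceq> Cst (1 / 2) * cap_bound d \<epsilon> a"
      by (intro sos_le_mult_left sos_Cst) auto
    then show ?thesis by (simp flip: mult.assoc Cst_mult)
  qed
  ultimately have "Cst (\<epsilon> / 2) * f1 ^ 2 + Cst (1 / (2 * \<epsilon>)) * f2 ^ 2
      \<preceq> Cst (1 / 2) * cap_bound d \<epsilon> a + Cst (1 / 2) * cap_bound d \<epsilon> a"
    by (rule sos_le_add)
  also have "\<dots> = cap_bound d \<epsilon> a" by (simp flip: distrib_right Cst_add)
  finally have "Cst c * (Cst (\<epsilon> / 2) * f1 ^ 2 + Cst (1 / (2 * \<epsilon>)) * f2 ^ 2) \<preceq> Cst c * cap_bound d \<epsilon> a"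
    using c by (intro sos_le_mult_left sos_Cst) auto
  then have "sos (Cst c * cap_bound d \<epsilon> a + Cst \<kappa> * (f1 * f2))"
    using sos_add[OF _ sos_weighted_am_gm[OF e(1) c, of f1 f2]] unfolding sos_le_def
    by (metis (no_types) add.assoc diff_add_cancel)
  moreover have "f1 * f2 = lin_poly a ^ (d - card S) * (\<Prod>s\<in>S. ortho_poly a (v s))"
  proof -
    have "(\<Prod>s\<in>S. ortho_poly a (v s)) = g1 * g2"
      unfolding g1_def g2_def S2_def
      using prod.subset_diff[OF S1(1) S(1), of "\<lambda>s. ortho_poly a (v s)"] by (simp add: mult.commute)
    moreover have "d - card S = (d div 2 - card S1) + (d div 2 - card S2)"
      using card k d by (auto elim!: evenE)
    ultimately show ?thesis unfolding f1_def f2_def by (simp add: power_add mult_ac)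
  qed
  ultimately show ?thesis by simp
qed

section \<open>A form near a unit vector\<close>

text \<open>
  The product of the \<open>d\<close> factors \<open>a\<^sub>i u + w\<^sub>i\<close> expands into \<open>2\<^sup>d\<close> terms, one for each set \<open>X\<close> of
  factors from which \<open>a\<^sub>i u\<close> is chosen. The full set gives the value at \<open>a\<close> times \<open>u\<^sup>d\<close>; every other term
  is mixed, with coefficient at most \<open>\<bar>c\<bar>\<close> because the coordinates of a unit vector are at most 1.
\<close>

lemma monomial_lower_bound:
  assumes a: "norm a = 1" and d: "even d" and e: "0 < \<epsilon>" "\<epsilon> \<le> 1"
    and deg: "monom_degree \<alpha> = d"
  shows "Cst (c * monom_value \<alpha> a) * lin_poly a ^ d
     \<preceq> Poly_Mapping.single \<alpha> c + Cst (2 ^ d * \<bar>c\<bar>) * cap_bound d \<epsilon> a"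
proof -
  let ?u = "lin_poly a"
  \<comment> \<open>an index set with one element for each factor of the monomial\<close>
  define A where "A = Sigma (UNIV :: 'a set) (\<lambda>i. {..<Poly_Mapping.lookup \<alpha> i})"
  have finA: "finite A" and cardA: "card A = d"
    using deg unfolding A_def monom_degree_def by (simp_all add: card_SigmaI)
  define \<kappa> where "\<kappa> X = c * (\<Prod>s\<in>X. a $ fst s)" for X :: "('a \<times> nat) set"
  define T where "T X = Cst (\<kappa> X) * (?u ^ (d - card (A - X)) * (\<Prod>s\<in>A - X. ortho_poly a (fst s)))"
    for X
  have "(\<Prod>i\<in>UNIV. Var i ^ Poly_Mapping.lookup \<alpha> i) = (\<Prod>s\<in>A. Var (fst s) :: 'a rpoly)"
    unfolding A_def by (subst prod.Sigma[symmetric, where g = "\<lambda>i _. Var i", simplified case_prod_unfold]) simp_all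
  also have "\<dots> = (\<Prod>s\<in>A. Cst (a $ fst s) * ?u + ortho_poly a (fst s))"
    by (simp add: ortho_poly_def)
  also have "\<dots> = (\<Sum>X\<in>Pow A. (\<Prod>s\<in>X. Cst (a $ fst s) * ?u) * (\<Prod>s\<in>A - X. ortho_poly a (fst s)))"
    by (rule prod_add[OF finA])
  finally have "Poly_Mapping.single \<alpha> c = (\<Sum>X\<in>Pow A. Cst c *
      ((\<Prod>s\<in>X. Cst (a $ fst s) * ?u) * (\<Prod>s\<in>A - X. ortho_poly a (fst s))))"
    by (simp add: single_eq_prod_Var sum_distrib_left)
  also have "\<dots> = (\<Sum>X\<in>Pow A. T X)"
  proof (rule sum.cong[OF refl])
    fix X assume X: "X \<in> Pow A"
    then have "card X \<le> d" using card_mono[OF finA] cardA by auto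
    then have "d - card (A - X) = card X"
      using X card_Diff_subset[of X A] finite_subset[OF _ finA] cardA by auto
    then show "Cst c * ((\<Prod>s\<in>X. Cst (a $ fst s) * ?u) * (\<Prod>s\<in>A - X. ortho_poly a (fst s))) = T X"
      unfolding T_def \<kappa>_def by (simp add: prod.distrib Cst_mult Cst_prod mult_ac)
  qed
  finally have expand: "Poly_Mapping.single \<alpha> c = T A + sum T (Pow A - {A})"
    using finA by (simp add: sum.remove[of "Pow A" A])
  have "(\<Prod>s\<in>A. a $ fst s) = monom_value \<alpha> a"
    unfolding A_def monom_value_def
    by (subst prod.Sigma[symmetric, where g = "\<lambda>i _. a $ i", simplified case_prod_unfold]) simp_all
  then have TA: "T A = Cst (c * monom_value \<alpha> a) * ?u ^ d" by (simp add: T_def \<kappa>_def)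
  have "sos (Cst \<bar>c\<bar> * cap_bound d \<epsilon> a + T X)" if X: "X \<in> Pow A - {A}" for X
  proof -
    have "\<bar>\<Prod>s\<in>X. a $ fst s\<bar> \<le> 1"
      unfolding abs_prod using component_le_norm_cart[of a] a by (intro prod_le_1) auto
    then have "\<bar>\<kappa> X\<bar> \<le> \<bar>c\<bar>"
      unfolding \<kappa>_def abs_mult by (simp add: mult_left_le)
    moreover have "A - X \<noteq> {}" "card (A - X) \<le> d" using X card_mono[OF finA, of "A - X"] cardA by auto
    ultimately show ?thesis
      unfolding T_def using finA by (intro mixed_term_bound a d e) auto
  qed
  then have "sos (\<Sum>X\<in>Pow A - {A}. Cst \<bar>c\<bar> * cap_bound d \<epsilon> a + T X)" by (rule sos_sum)
  \<comment> \<open>one spare copy of the error, for the full set, rounds the number of terms up to \<open>2\<^sup>d\<close>\<close>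
  moreover have "sos (Cst \<bar>c\<bar> * cap_bound d \<epsilon> a)"
    unfolding cap_bound_def using a d e
    by (intro sos_mult sos_add sos_Cst sos_even_power sos_h_poly) auto
  ultimately have "sos (Cst \<bar>c\<bar> * cap_bound d \<epsilon> a
      + (\<Sum>X\<in>Pow A - {A}. Cst \<bar>c\<bar> * cap_bound d \<epsilon> a + T X))"
    by (intro sos_add)
  also have "Cst \<bar>c\<bar> * cap_bound d \<epsilon> a + (\<Sum>X\<in>Pow A - {A}. Cst \<bar>c\<bar> * cap_bound d \<epsilon> a + T X)
      = (\<Sum>X\<in>Pow A. Cst \<bar>c\<bar> * cap_bound d \<epsilon> a) + sum T (Pow A - {A})"
    using finA sum.remove[of "Pow A" A "\<lambda>_. Cst \<bar>c\<bar> * cap_bound d \<epsilon> a"]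
    by (simp only: sum.distrib finite_Pow_iff Pow_top add.assoc)
  also have "(\<Sum>X\<in>Pow A. Cst \<bar>c\<bar> * cap_bound d \<epsilon> a) = Cst (2 ^ d * \<bar>c\<bar>) * cap_bound d \<epsilon> a"
  proof -
    have "(\<Sum>X\<in>Pow A. Cst \<bar>c\<bar> * cap_bound d \<epsilon> a) = Cst (\<Sum>X\<in>Pow A. \<bar>c\<bar>) * cap_bound d \<epsilon> a"
      by (simp only: Cst_sum sum_distrib_right)
    then show ?thesis using finA cardA by (simp add: card_Pow)
  qed
  finally show ?thesis unfolding sos_le_def expand TA by (simp add: algebra_simps)
qed

definition form_variation :: "nat \<Rightarrow> 'n::finite rpoly \<Rightarrow> real" where
  "form_variation d p = 2 ^ d * (\<Sum>\<alpha>\<in>Poly_Mapping.keys p. \<bar>Poly_Mapping.lookup p \<alpha>\<bar>)"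

lemma form_variation_nonneg: "form_variation d p \<ge> 0"
  by (simp add: form_variation_def sum_nonneg)

text \<open>The constant in front of the error depends neither on \<open>a\<close> nor on \<open>\<epsilon>\<close>, so the net may vary with \<open>m\<close>.\<close>

lemma form_lower_bound:
  assumes a: "norm a = 1" and d: "even d" and e: "0 < \<epsilon>" "\<epsilon> \<le> 1" and p: "is_form d p"
  shows "Cst (poly_value p a) * lin_poly a ^ d \<preceq> p + Cst (form_variation d p) * cap_bound d \<epsilon> a"
proof -
  let ?c = "Poly_Mapping.lookup p"
  have "(\<Sum>\<alpha>\<in>Poly_Mapping.keys p. Cst (?c \<alpha> * monom_value \<alpha> a) * lin_poly a ^ d)
     \<preceq> (\<Sum>\<alpha>\<in>Poly_Mapping.keys p. Poly_Mapping.single \<alpha> (?c \<alpha>) + Cst (2 ^ d * \<bar>?c \<alpha>\<bar>) * cap_bound d \<epsilon> a)"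
    using p unfolding is_form_def by (intro sos_le_sum monomial_lower_bound a d e) auto
  moreover have "(\<Sum>\<alpha>\<in>Poly_Mapping.keys p. Cst (?c \<alpha> * monom_value \<alpha> a) * lin_poly a ^ d)
     = Cst (poly_value p a) * lin_poly a ^ d"
    by (simp add: poly_value_def Cst_sum sum_distrib_right)
  moreover have "(\<Sum>\<alpha>\<in>Poly_Mapping.keys p. Poly_Mapping.single \<alpha> (?c \<alpha>) + Cst (2 ^ d * \<bar>?c \<alpha>\<bar>) * cap_bound d \<epsilon> a)
     = p + Cst (form_variation d p) * cap_bound d \<epsilon> a"
    by (simp add: sum.distrib form_variation_def sum_distrib_left Cst_sum sum_distrib_right flip: rpoly_as_sum)
  ultimately show ?thesis by simp
qed

section \<open>Certificates\<close>

lemma t_const_lower: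
  assumes "even d" "d \<ge> 2" "m \<ge> 1"
  shows "t_const d m \<ge> real m ^ 2 / real d"
proof -
  let ?S = "\<Sum>k=1..d div 2. 1 / real m ^ (2 * k)"
  have "?S \<le> (\<Sum>k=1..d div 2. 1 / real m ^ 2)"
    using assms by (intro sum_mono divide_left_mono power_increasing) auto
  also have "\<dots> \<le> real d / real m ^ 2"
    by (simp add: divide_right_mono)
  finally have "?S \<le> real d / real m ^ 2" .
  moreover have "?S > 0" using assms by (intro sum_pos) auto
  ultimately show ?thesis
    unfolding t_const_def using le_imp_inverse_le[of ?S "real d / real m ^ 2"] by simp
qed

lemma even_power_le_norm2_power:
  assumes "norm a = 1" "even d" "k \<le> d div 2"
  shows "(norm2_poly - lin_poly a ^ 2) ^ k * lin_poly a ^ (d - 2 * k) \<preceq> norm2_poly ^ (d div 2)"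
proof -
  have N: "sos (norm2_poly :: 'a rpoly)"
    unfolding norm2_poly_def by (intro sos_sum sos_square)
  have "norm2_poly - lin_poly a ^ 2 \<preceq> norm2_poly" "lin_poly a ^ 2 \<preceq> norm2_poly"
    using assms(1) by (simp_all add: sos_le_def sos_square sos_ortho_norm2)
  then have "(norm2_poly - lin_poly a ^ 2) ^ k * (lin_poly a ^ 2) ^ (d div 2 - k)
     \<preceq> norm2_poly ^ k * norm2_poly ^ (d div 2 - k)"
    using assms(1) N by (intro sos_le_mult sos_le_power sos_power sos_square sos_ortho_norm2)
  moreover have "d - 2 * k = 2 * (d div 2 - k)" using assms(2) by auto
  moreover have "norm2_poly ^ k * norm2_poly ^ (d div 2 - k) = (norm2_poly :: 'a rpoly) ^ (d div 2)"
    using assms(3) by (simp flip: power_add)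
  ultimately show ?thesis by (simp add: power_mult)
qed

text \<open>
  Feasibility for \<open>m = 1\<close>, where the disjunction gives no information and the certificate has to be a plain
  sum of squares: \<open>|x|\<^sup>d\<close> dominates both \<open>u\<^sup>d\<close> and every summand of \<open>h\<close>, hence the error with \<open>\<epsilon> = 1\<close>.
\<close>

lemma shifted_form_sos:
  assumes a: "norm a = 1" and d: "even d" and q: "is_form d q" and pos: "poly_value q a \<ge> 0"
  shows "\<exists>\<delta>. sos (q + Cst \<delta> * norm2_poly ^ (d div 2))"
proof -
  let ?M = "form_variation d q" and ?N = "norm2_poly ^ (d div 2) :: 'a rpoly"
  let ?\<delta> = "?M * (1 + real (d div 2))"
  have u: "lin_poly a ^ d \<preceq> ?N" using even_power_le_norm2_power[OF a d, of 0] by simp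
  have "h_poly d a \<preceq> (\<Sum>k=1..d div 2. ?N)"
    unfolding h_poly_def by (intro sos_le_sum even_power_le_norm2_power a d) auto
  also have "(\<Sum>k=1..d div 2. ?N) = Cst (real (d div 2)) * ?N"
  proof -
    have "(\<Sum>k=1..d div 2. ?N) = Cst (\<Sum>k=1..d div 2. 1) * ?N"
      by (simp only: Cst_sum sum_distrib_right Cst_1 mult_1)
    then show ?thesis by simp
  qed
  finally have "cap_bound d 1 a \<preceq> Cst (1 + real (d div 2)) * ?N"
    unfolding cap_bound_def using sos_le_add[OF u] by (simp add: Cst_add distrib_right)
  then have "Cst ?M * cap_bound d 1 a \<preceq> Cst ?M * (Cst (1 + real (d div 2)) * ?N)"
    by (intro sos_le_mult_left sos_Cst form_variation_nonneg)
  then have "q + Cst ?M * cap_bound d 1 a \<preceq> q + Cst ?\<delta> * ?N"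
    by (intro sos_le_add sos_le_refl) (simp add: Cst_mult mult.assoc)
  with form_lower_bound[OF a d _ _ q, of 1]
  have "Cst (poly_value q a) * lin_poly a ^ d \<preceq> q + Cst ?\<delta> * ?N"
    using sos_le_trans by simp
  moreover have "sos (Cst (poly_value q a) * lin_poly a ^ d)"
    using pos d by (intro sos_mult sos_Cst sos_even_power)
  ultimately have "sos (q + Cst ?\<delta> * ?N)"
    unfolding sos_le_def using sos_add by fastforce
  then show ?thesis ..
qed

text \<open>
  With \<open>\<epsilon> = 1/m\<close> the error is \<open>M/m u\<^sup>d + M m h\<close>. The multiplier \<open>M d/m\<close> is the smallest for which
  \<open>t \<ge> m\<^sup>2/d\<close> guarantees that the term \<open>t h\<close> of the cap polynomial pays for \<open>M m h\<close>; the coefficient of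
  \<open>|x|\<^sup>d\<close> then has to pay for \<open>M/m\<close> and for this multiplier on \<open>u\<^sup>d\<close>.
\<close>

lemma cap_certificate:
  assumes a: "norm a = 1" and d: "even d" "d \<ge> 2" and m: "m \<ge> 1"
    and q: "is_form d q" and pos: "poly_value q a \<ge> 0"
  defines "M \<equiv> form_variation d q"
  shows "sos (q + Cst (M * (real d + 1) / real m) * norm2_poly ^ (d div 2)
              - Cst (M * real d / real m) * cap_poly d m a)"
proof -
  let ?u = "lin_poly a" and ?h = "h_poly d a" and ?N = "norm2_poly ^ (d div 2) :: 'a rpoly"
  define \<delta> where "\<delta> = M * (real d + 1) / real m"
  define \<mu> where "\<mu> = M * real d / real m"
  define t where "t = t_const d m"
  have M: "M \<ge> 0" unfolding M_def by (rule form_variation_nonneg)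
  have \<delta>0: "\<delta> \<ge> 0" and \<mu>0: "\<mu> \<ge> 0" using M unfolding \<delta>_def \<mu>_def by auto
  have split: "\<delta> = M / real m + \<mu>" unfolding \<delta>_def \<mu>_def by (simp add: distrib_left add_divide_distrib)
  have "\<mu> * (real m ^ 2 / real d) \<le> \<mu> * t"
    unfolding t_def using \<mu>0 t_const_lower[OF d m] by (rule mult_left_mono[rotated])
  moreover have "\<mu> * (real m ^ 2 / real d) = M * real m"
    unfolding \<mu>_def using d m by (simp add: power2_eq_square)
  ultimately have t: "M * real m \<le> \<mu> * t" by simp
  have "sos (q + Cst M * cap_bound d (1 / real m) a - Cst (poly_value q a) * ?u ^ d)"
    using form_lower_bound[OF a d(1) _ _ q, of "1 / real m"] m unfolding sos_le_def M_def by simp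
  moreover have "sos (Cst (poly_value q a) * ?u ^ d)"
    using pos d by (intro sos_mult sos_Cst sos_even_power)
  moreover have "sos (Cst \<delta> * (?N - ?u ^ d))"
    using even_power_le_norm2_power[OF a d(1), of 0] \<delta>0
    unfolding sos_le_def by (intro sos_mult sos_Cst) simp_all
  moreover have "sos (Cst (\<mu> * t - M * real m) * ?h)"
    using t a d by (intro sos_mult sos_Cst sos_h_poly) auto
  ultimately have "sos ((q + Cst M * cap_bound d (1 / real m) a - Cst (poly_value q a) * ?u ^ d)
     + Cst (poly_value q a) * ?u ^ d + Cst \<delta> * (?N - ?u ^ d) + Cst (\<mu> * t - M * real m) * ?h)"
    by (intro sos_add)
  also have "(q + Cst M * cap_bound d (1 / real m) a - Cst (poly_value q a) * ?u ^ d)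
     + Cst (poly_value q a) * ?u ^ d + Cst \<delta> * (?N - ?u ^ d) + Cst (\<mu> * t - M * real m) * ?h
     = q + Cst \<delta> * ?N - Cst \<mu> * cap_poly d m a"
  proof -
    have "Cst M * cap_bound d (1 / real m) a = Cst (M / real m) * ?u ^ d + Cst (M * real m) * ?h"
      unfolding cap_bound_def by (simp add: distrib_left flip: mult.assoc Cst_mult)
    moreover have "Cst \<delta> = Cst (M / real m) + (Cst \<mu> :: 'a rpoly)" unfolding split Cst_add ..
    ultimately show ?thesis
      unfolding cap_poly_def t_def[symmetric] by (simp add: Cst_diff Cst_mult algebra_simps)
  qed
  finally show ?thesis unfolding \<delta>_def \<mu>_def .
qed

section \<open>The optimal values\<close>

lemma poly_value_nonneg_of_disj_cone:
  assumes "p \<in> disj_cone d dbar D" "Q \<in> D" "x \<in> disj_region Q"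
  shows "poly_value p x \<ge> 0"
proof -
  obtain s0 s where s: "sos s0" "\<forall>q\<in>Q. sos (s q)" "p = s0 + (\<Sum>q\<in>Q. s q * q)"
    using assms unfolding disj_cone_def by blast
  have "(\<Sum>q\<in>Q. poly_value (s q) x * poly_value q x) \<ge> 0"
    using s(2) assms(3) unfolding disj_region_def
    by (intro sum_nonneg mult_nonneg_nonneg) (auto intro: poly_value_sos_nonneg)
  then show ?thesis using s(1,3) by (simp add: poly_value_sos_nonneg)
qed

lemma feasible_gamma_le_sphere_min:
  fixes p :: "'n::finite rpoly"
  assumes D: "algebraic_disjunction D" and g: "\<gamma> \<in> feasible_gammas d p D"
  shows "\<gamma> \<le> sphere_min p"
  unfolding sphere_min_def
proof (rule cINF_greatest)
  obtain y :: "real ^ 'n" where "norm y = 1" using vector_choose_size[of 1] by auto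
  then show "sphere (0 :: real ^ 'n) 1 \<noteq> {}" by (auto simp: set_eq_iff)
next
  fix x :: "real ^ 'n" assume x: "x \<in> sphere 0 1"
  obtain Q where "Q \<in> D" "x \<in> disj_region Q"
    using D unfolding algebraic_disjunction_def by blast
  then have "poly_value (p - Cst \<gamma> * norm2_poly ^ (d div 2)) x \<ge> 0"
    using g poly_value_nonneg_of_disj_cone unfolding feasible_gammas_def by blast
  then show "\<gamma> \<le> poly_value p x" using x by simp
qed

lemma sphere_min_le:
  assumes "norm a = 1"
  shows "sphere_min p \<le> poly_value p a"
proof -
  have "continuous_on (sphere 0 1) (poly_value p)"
    unfolding poly_value_def monom_value_def by (intro continuous_intros)
  then have "compact (poly_value p ` sphere 0 1)"
    by (rule compact_continuous_image) simp
  then show ?thesis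
    unfolding sphere_min_def using assms
    by (intro cINF_lower bounded_imp_bdd_below compact_imp_bounded) auto
qed

lemma disj_cone_singletonsI:
  assumes "total_degree p \<le> d"
    and "\<And>q. q \<in> A \<Longrightarrow> \<exists>\<mu>\<ge>0. sos (p - Cst \<mu> * q) \<and> total_degree (p - Cst \<mu> * q) \<le> dbar
           \<and> total_degree (Cst \<mu> * q) \<le> dbar"
  shows "p \<in> disj_cone d dbar ((\<lambda>q. {q}) ` A)"
proof -
  have "\<exists>s0 s. sos s0 \<and> (\<forall>q\<in>Q. sos (s q)) \<and> p = s0 + (\<Sum>q\<in>Q. s q * q) \<and>
            total_degree s0 \<le> dbar \<and> (\<forall>q\<in>Q. total_degree (s q * q) \<le> dbar)"
    if "Q \<in> (\<lambda>q. {q}) ` A" for Q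
  proof -
    obtain q where q: "q \<in> A" "Q = {q}" using \<open>Q \<in> _\<close> by blast
    then obtain \<mu> where "\<mu> \<ge> 0" "sos (p - Cst \<mu> * q)" "total_degree (p - Cst \<mu> * q) \<le> dbar"
      "total_degree (Cst \<mu> * q) \<le> dbar" using assms(2) by blast
    then show ?thesis
      unfolding q(2) by (intro exI[of _ "p - Cst \<mu> * q"] exI[of _ "\<lambda>_. Cst \<mu>"]) (simp add: sos_Cst)
  qed
  then show ?thesis using assms(1) unfolding disj_cone_def by blast
qed

theorem theorem7:
  fixes p :: "'n::finite rpoly" and d :: nat and N :: "nat \<Rightarrow> (real ^ 'n) set"
  assumes "even d" and "d \<ge> 2"
    and "is_form d p"
    and "\<And>m. m \<ge> 2 \<Longrightarrow> sphere_net m (N m)"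
  shows "(\<forall>m\<ge>1. feasible_gammas d p (disj_family d N m) \<noteq> {} \<and>
                 bdd_above (feasible_gammas d p (disj_family d N m))) \<and>
         (\<lambda>m. sphere_min p - opt_value d p (disj_family d N m)) \<in> O(\<lambda>m. 1 / real m)"
proof -
  let ?F = "\<lambda>m. feasible_gammas d p (disj_family d N m)"
  let ?N = "norm2_poly ^ (d div 2) :: 'n rpoly"
  \<comment> \<open>Subtracting the minimum makes \<open>q(a) \<ge> 0\<close> at all net points, so that one constant serves every \<open>m\<close>.\<close>
  define q where "q = p - Cst (sphere_min p) * ?N"
  define C where "C = form_variation d q * (real d + 1)"
  have form: "is_form d (p - Cst \<gamma> * ?N)" for \<gamma>
    using assms by (intro is_form_diff is_form_Cst_mult is_form_norm2_power)
  then have q: "is_form d q" unfolding q_def .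
  have q_shift: "p - Cst (sphere_min p - \<delta>) * ?N = q + Cst \<delta> * ?N" for \<delta>
    unfolding q_def by (simp add: Cst_diff algebra_simps)
  have q_pos: "poly_value q a \<ge> 0" if "norm a = 1" for a
    using sphere_min_le[OF that, of p] that unfolding q_def by simp
  have upper: "\<gamma> \<le> sphere_min p" if "\<gamma> \<in> ?F m" for \<gamma> m
    using feasible_gamma_le_sphere_min[OF algebraic_disjunction_disj_family that] assms by blast
  then have bdd: "bdd_above (?F m)" for m unfolding bdd_above_def by blast
  have lower: "sphere_min p - C / real m \<in> ?F m" if m: "m \<ge> 2" for m
  proof -
    let ?p = "q + Cst (C / real m) * ?N"
    let ?\<mu> = "form_variation d q * real d / real m"
    have "?p \<in> disj_cone d d ((\<lambda>q. {q}) ` (cap_poly d m ` N m))"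
    proof (rule disj_cone_singletonsI)
      show "total_degree ?p \<le> d" using form total_degree_form unfolding q_shift[symmetric] by blast
    next
      fix c assume "c \<in> cap_poly d m ` N m"
      then obtain a where a: "a \<in> N m" "c = cap_poly d m a" by blast
      then have n: "norm a = 1" using assms(4)[OF m] unfolding sphere_net_def by auto
      have "sos (?p - Cst ?\<mu> * c)"
        unfolding a(2) C_def using cap_certificate[OF n assms(1,2) _ q q_pos[OF n]] m by simp
      moreover have "is_form d (Cst ?\<mu> * c)" unfolding a(2) by (intro is_form_Cst_mult is_form_cap_poly)
      moreover from this have "is_form d (?p - Cst ?\<mu> * c)"
        using is_form_diff[OF form[of "sphere_min p - C / real m"]] unfolding q_shift by blast
      moreover have "?\<mu> \<ge> 0" by (simp add: form_variation_nonneg)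
      ultimately show "\<exists>\<mu>\<ge>0. sos (?p - Cst \<mu> * c) \<and> total_degree (?p - Cst \<mu> * c) \<le> d
           \<and> total_degree (Cst \<mu> * c) \<le> d" using total_degree_form by blast
    qed
    then show ?thesis
      using m unfolding feasible_gammas_def disj_family_def by (simp add: q_shift image_image)
  qed
  have "?F m \<noteq> {}" if "m \<ge> 1" for m
  proof (cases "m = 1")
    case True
    obtain a :: "real ^ 'n" where a: "norm a = 1" using vector_choose_size[of 1] by auto
    obtain \<delta> where \<delta>: "sos (q + Cst \<delta> * ?N)"
      using shifted_form_sos[OF a assms(1) q q_pos[OF a]] by blast
    have deg: "total_degree (q + Cst \<delta> * ?N) \<le> d"
      using form total_degree_form unfolding q_shift[symmetric] by blast
    have "q + Cst \<delta> * ?N \<in> disj_cone d d ((\<lambda>q. {q}) ` {0})"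
      by (rule disj_cone_singletonsI[OF deg]) (use \<delta> deg total_degree_form[of d 0] in auto)
    then have "sphere_min p - \<delta> \<in> ?F m"
      using True unfolding feasible_gammas_def disj_family_def by (simp add: q_shift)
    then show ?thesis by blast
  next
    case False
    then show ?thesis using lower[of m] that by fastforce
  qed
  moreover have "(\<lambda>m. sphere_min p - opt_value d p (disj_family d N m)) \<in> O(\<lambda>m. 1 / real m)"
  proof (rule bigoI[of _ C])
    have "norm (sphere_min p - opt_value d p (disj_family d N m)) \<le> C * norm (1 / real m)"
      if m: "m \<ge> 2" for m
    proof -
      have "opt_value d p (disj_family d N m) \<le> sphere_min p"
        unfolding opt_value_def using lower[OF m] upper by (intro cSup_least) auto
      moreover have "sphere_min p - C / real m \<le> opt_value d p (disj_family d N m)"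
        unfolding opt_value_def by (intro cSup_upper lower m bdd)
      ultimately show ?thesis by simp
    qed
    then show "\<forall>\<^sub>F m in sequentially. norm (sphere_min p - opt_value d p (disj_family d N m))
        \<le> C * norm (1 / real m)"
      unfolding eventually_sequentially by blast
  qed
  ultimately show ?thesis using bdd by (intro conjI allI impI)
qed

end
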